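(* For all integers $n\geqslant3$, if $K_n$ is the complete graph on $n$ vertices and $H$ is a Hamilton cycle of $K_n$, then the energy of the graph $K_n-H$ is $$E(K_n-H)=2\bigl(n-3-(\lfloor2n/3\rfloor-\lfloor n/3\rfloor)\bigr)+2\,\frac{\sin\bigl((\lfloor n/3\rfloor+1/2)2\pi/n\bigr)-\sin\bigl((\lfloor2n/3\rfloor+1/2)2\pi/n\bigr)}{\sin(\pi/n)}.$$
   Context: The energy of a graph $G$ on $n$ vertices is $E(G)=\sum_{k=1}^n|\lambda_k|$, where $\lambda_1,\ldots,\lambda_n$ are the eigenvalues, counted with multiplicity, of its adjacency matrix. The graph $K_n-H$ is obtained from the complete graph $K_n$ by removing the edges of the Hamilton cycle $H$ (keeping all $n$ vertices). $\lfloor x\rfloor$ is the greatest integer smaller than or equal to $x$. *)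

theory Defs
  imports
    "HOL-Analysis.Analysis"
    "HOL-Computational_Algebra.Computational_Algebra"
    "Graph_Theory.Kuratowski"
    "Jordan_Normal_Form.Char_Poly"
begin

text \<open>
  As in the Graph_Theory entry, an undirected simple graph is a symmetric digraph without loops
  and parallel arcs (locale \<^locale>\<open>graph\<close>), each edge being a pair of opposite arcs. The complete
  graph on \<open>n\<close> vertices is \<^const>\<open>complete_digraph\<close>.
\<close>

text \<open>
  In a symmetric digraph the closed walk \<open>u, v, u\<close> satisfies \<^const>\<open>pre_digraph.cycle\<close>, but it is
  not a cycle of the undirected graph; hence the bound on the length.
\<close>

definition hamilton_cycle :: "('a, 'b) pre_digraph \<Rightarrow> 'b awalk \<Rightarrow> bool" where
  "hamilton_cycle G p \<longleftrightarrow>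
     pre_digraph.cycle G p \<and> 3 \<le> length p \<and> head G ` set p = verts G"

text \<open>
  A cycle traverses each of its edges along only one of the two arcs; both have to go.
\<close>

definition remove_edges :: "('a, 'b) pre_digraph \<Rightarrow> 'b set \<Rightarrow> ('a, 'b) pre_digraph" where
  "remove_edges G F =
     G\<lparr>arcs := {a \<in> arcs G. \<forall>e\<in>F. {tail G a, head G a} \<noteq> {tail G e, head G e}}\<rparr>"

definition adjacency_matrix :: "('a, 'b) pre_digraph \<Rightarrow> 'a list \<Rightarrow> complex mat" where
  "adjacency_matrix G vs =
     mat (length vs) (length vs) (\<lambda>(i, j). of_bool ((vs ! i, vs ! j) \<in> arcs_ends G))"

text \<open>
  The eigenvalues with multiplicity are the roots of the characteristic polynomial. The choice of
  the vertex enumeration is immaterial, see \<open>graph_energy_eq\<close> below.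
\<close>

definition graph_energy :: "('a, 'b) pre_digraph \<Rightarrow> real" where
  "graph_energy G =
     (let A = adjacency_matrix G (SOME vs. distinct vs \<and> set vs = verts G)
      in \<Sum>z\<in>#proots (char_poly A). cmod z)"

lemma sum_of_bool_nth:
  fixes f :: "'a \<Rightarrow> complex"
  assumes "distinct ws" "x \<in> set ws"
  shows "(\<Sum>k<length ws. of_bool (x = ws ! k) * f (ws ! k)) = f x"
proof -
  have "(\<Sum>k<length ws. of_bool (x = ws ! k) * f (ws ! k)) = (\<Sum>y\<in>set ws. of_bool (x = y) * f y)"
    using sum.reindex_bij_betw[OF bij_betw_nth[OF assms(1) refl refl], of "\<lambda>y. of_bool (x = y) * f y"]
    by simp
  also have "\<dots> = (\<Sum>y\<in>set ws. if x = y then f y else 0)"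
    by (intro sum.cong) auto
  also have "\<dots> = f x"
    using assms(2) by simp
  finally show ?thesis .
qed

lemma similar_adjacency_matrix:
  assumes vs: "distinct vs" and ws: "distinct ws" and eq: "set vs = set ws"
  shows "similar_mat (adjacency_matrix G vs) (adjacency_matrix G ws)"
proof -
  define n where "n = length vs"
  have lw: "length ws = n"
    using vs ws eq by (metis distinct_card n_def)
  define R :: "'a list \<Rightarrow> 'a list \<Rightarrow> complex mat"
    where "R xs ys = mat n n (\<lambda>(i, j). of_bool (xs ! i = ys ! j))" for xs ys
  have RR: "R xs ys * R ys xs = 1\<^sub>m n"
    if "distinct xs" "distinct ys" "set xs = set ys" "length xs = n" "length ys = n" for xs ys
  proof (rule eq_matI)
    fix i j assume "i < dim_row (1\<^sub>m n :: complex mat)" "j < dim_col (1\<^sub>m n :: complex mat)"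
    then have ij: "i < n" "j < n" by simp_all
    have "(R xs ys * R ys xs) $$ (i, j) = (\<Sum>k<length ys. of_bool (xs ! i = ys ! k) * of_bool (ys ! k = xs ! j))"
      using ij that by (simp add: R_def scalar_prod_def atLeast0LessThan)
    also have "\<dots> = of_bool (xs ! i = xs ! j)"
      using that ij nth_mem[of i xs] by (intro sum_of_bool_nth) auto
    also have "\<dots> = 1\<^sub>m n $$ (i, j)"
      using ij that by (simp add: nth_eq_iff_index_eq)
    finally show "(R xs ys * R ys xs) $$ (i, j) = 1\<^sub>m n $$ (i, j)" .
  qed (simp_all add: R_def)
  have R [simp]: "R xs ys \<in> carrier_mat n n" for xs ys
    by (simp add: R_def)
  have A: "adjacency_matrix G xs \<in> carrier_mat n n" if "length xs = n" for xs
    using that by (simp add: adjacency_matrix_def)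
  have AR: "adjacency_matrix G vs * R vs ws = R vs ws * adjacency_matrix G ws"
  proof (rule eq_matI)
    fix i j assume "i < dim_row (R vs ws * adjacency_matrix G ws)"
      "j < dim_col (R vs ws * adjacency_matrix G ws)"
    then have ij: "i < n" "j < n" using lw by (simp_all add: R_def adjacency_matrix_def)
    have mem: "vs ! i \<in> set ws" "ws ! j \<in> set vs"
      using ij lw eq nth_mem[of i vs] nth_mem[of j ws] by (auto simp: n_def)
    have "(adjacency_matrix G vs * R vs ws) $$ (i, j)
        = (\<Sum>k<length vs. of_bool ((vs ! i, vs ! k) \<in> arcs_ends G) * of_bool (vs ! k = ws ! j))"
      using ij lw by (simp add: R_def adjacency_matrix_def scalar_prod_def atLeast0LessThan n_def)
    also have "\<dots> = (\<Sum>k<length vs. of_bool (ws ! j = vs ! k) * of_bool ((vs ! i, vs ! k) \<in> arcs_ends G))"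
      by (intro sum.cong) auto
    also have "\<dots> = of_bool ((vs ! i, ws ! j) \<in> arcs_ends G)"
      using vs mem by (intro sum_of_bool_nth) auto
    also have "\<dots> = (\<Sum>k<length ws. of_bool (vs ! i = ws ! k) * of_bool ((ws ! k, ws ! j) \<in> arcs_ends G))"
      using ws mem by (intro sum_of_bool_nth[symmetric]) auto
    also have "\<dots> = (R vs ws * adjacency_matrix G ws) $$ (i, j)"
      using ij lw by (simp add: R_def adjacency_matrix_def scalar_prod_def atLeast0LessThan)
    finally show "(adjacency_matrix G vs * R vs ws) $$ (i, j)
        = (R vs ws * adjacency_matrix G ws) $$ (i, j)" .
  qed (use lw in \<open>simp_all add: R_def adjacency_matrix_def n_def\<close>)
  have Av: "adjacency_matrix G vs \<in> carrier_mat n n" and Aw: "adjacency_matrix G ws \<in> carrier_mat n n"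
    using A lw by (simp_all add: n_def)
  have lv: "length vs = n"
    by (simp add: n_def)
  note RR1 = RR[OF vs ws eq lv lw] and RR2 = RR[OF ws vs eq[symmetric] lw lv]
  have "adjacency_matrix G vs = adjacency_matrix G vs * (R vs ws * R ws vs)"
    using right_mult_one_mat[OF Av] by (simp add: RR1)
  also have "\<dots> = R vs ws * adjacency_matrix G ws * R ws vs"
    using assoc_mult_mat[OF Av R R, of vs ws ws vs] AR by simp
  finally have "similar_mat_wit (adjacency_matrix G vs) (adjacency_matrix G ws) (R vs ws) (R ws vs)"
    by (intro similar_mat_witI[OF RR1 RR2 _ Av Aw R R])
  then show ?thesis
    by (auto simp: similar_mat_def)
qed

lemma graph_energy_eq:
  assumes "distinct vs" "set vs = verts G"
  shows "graph_energy G = (\<Sum>z\<in>#proots (char_poly (adjacency_matrix G vs)). cmod z)"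
proof -
  let ?ws = "SOME vs. distinct vs \<and> set vs = verts G"
  have "distinct ?ws \<and> set ?ws = verts G"
    using assms by (intro someI[of "\<lambda>vs. distinct vs \<and> set vs = verts G" vs]) simp
  then have "char_poly (adjacency_matrix G ?ws) = char_poly (adjacency_matrix G vs)"
    using assms by (intro char_poly_similar similar_adjacency_matrix) auto
  then show ?thesis
    by (simp add: graph_energy_def)
qed

end

theory Submission
  imports Defs
begin

text \<open>
  Listing the vertices in the order in which the Hamilton cycle visits them turns the adjacency
  matrix into a circulant matrix: whether the vertices number \<open>i\<close> and \<open>j\<close> are adjacent in
  \<open>K\<^sub>n - H\<close> depends only on \<open>j - i\<close> modulo \<open>n\<close>, the excluded residues being \<open>0\<close> and \<open>\<plusminus>1\<close>
  (\<open>graph_energy_remove_hamilton_cycle\<close>). The characters of the cyclic group of order \<open>n\<close>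
  diagonalise every circulant matrix (\<open>char_poly_circulant\<close>), and here the \<open>k\<close>-th eigenvalue is the
  \<open>k\<close>-th Fourier coefficient of the indicator function of the allowed residues,
  \<open>\<mu>\<^sub>k = n [k = 0] - 1 - 2 cos (2 \<pi> k / n)\<close> (\<open>circulant_eigenvalue_co_cycle_row\<close>).

  These numbers add up to the trace, which is zero, so the energy is twice the sum of the
  nonnegative ones. These are \<open>\<mu>\<^sub>0 = n - 3\<close> and the \<open>\<mu>\<^sub>k\<close> with \<open>cos (2 \<pi> k / n) \<le> - 1/2\<close>, that is
  with \<open>n / 3 \<le> k \<le> 2 n / 3\<close>. The boundary values \<open>k = n / 3\<close> and \<open>k = 2 n / 3\<close> contribute zero, so
  \<open>k\<close> may be taken to range over \<open>\<lfloor>n / 3\<rfloor> < k \<le> \<lfloor>2 n / 3\<rfloor>\<close> in all cases; the constant parts then give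
  the difference of the two floors, and the cosines telescope to the quotient of sines
  (\<open>sum_cos_telescope\<close>).
\<close>

section \<open>Characters of the cyclic group\<close>

definition cyclic_char :: "nat \<Rightarrow> int \<Rightarrow> complex" where
  "cyclic_char n a = cis (2 * pi * of_int a / of_nat n)"

lemma cyclic_char_0 [simp]: "cyclic_char n 0 = 1"
  by (simp add: cyclic_char_def)

lemma cyclic_char_add: "cyclic_char n (a + b) = cyclic_char n a * cyclic_char n b"
  by (simp add: cyclic_char_def cis_mult add_divide_distrib distrib_left)

lemma cyclic_char_eq_1_iff:
  assumes "n > 0"
  shows "cyclic_char n a = 1 \<longleftrightarrow> int n dvd a"
proof -
  have "cyclic_char n a = 1 \<longleftrightarrow> cos (2 * pi * of_int a / of_nat n) = 1"
    using cos_one_sin_zero by (auto simp: cyclic_char_def complex_eq_iff)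
  also have "\<dots> \<longleftrightarrow> (\<exists>m::int. 2 * pi * of_int a / of_nat n = of_int m * 2 * pi)"
    by (rule cos_one_2pi_int)
  also have "\<dots> \<longleftrightarrow> (\<exists>m::int. real_of_int a = real_of_int (int n * m))"
    using assms by (intro ex_cong1) (auto simp: field_simps)
  also have "\<dots> \<longleftrightarrow> int n dvd a"
    unfolding of_int_eq_iff dvd_def ..
  finally show ?thesis .
qed

lemma cyclic_char_cong:
  assumes "n > 0" "int n dvd a - b"
  shows "cyclic_char n a = cyclic_char n b"
  using cyclic_char_add[of n "a - b" b] cyclic_char_eq_1_iff[of n "a - b"] assms by simp

lemma cyclic_char_power: "cyclic_char n a ^ k = cyclic_char n (a * int k)"
  by (induction k) (simp_all add: cyclic_char_add algebra_simps)

text \<open>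
  Orthogonality of characters: if \<open>n\<close> does not divide \<open>a\<close>, this is a geometric sum over all powers of
  an \<open>n\<close>-th root of unity different from \<open>1\<close>.
\<close>

lemma sum_cyclic_char:
  assumes "n > 0"
  shows "(\<Sum>k<n. cyclic_char n (a * int k)) = (if int n dvd a then of_nat n else 0)"
proof (cases "int n dvd a")
  case True
  then have "cyclic_char n (a * int k) = 1" for k
    using assms by (simp add: cyclic_char_eq_1_iff)
  with True show ?thesis by simp
next
  case False
  let ?z = "cyclic_char n a"
  have "?z \<noteq> 1" "?z ^ n = 1"
    using assms False by (simp_all add: cyclic_char_eq_1_iff cyclic_char_power)
  then have "(\<Sum>k<n. ?z ^ k) = 0"
    by (simp add: geometric_sum)
  with False show ?thesis by (simp add: cyclic_char_power)
qed

section \<open>Circulant matrices\<close>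

definition circulant :: "nat \<Rightarrow> (int \<Rightarrow> complex) \<Rightarrow> complex mat" where
  "circulant n c = mat n n (\<lambda>(i, j). c ((int j - int i) mod int n))"

definition circulant_eigenvalue :: "nat \<Rightarrow> (int \<Rightarrow> complex) \<Rightarrow> nat \<Rightarrow> complex" where
  "circulant_eigenvalue n c k = (\<Sum>d<n. c (int d) * cyclic_char n (int k * int d))"

lemma sum_mod_shift:
  fixes f :: "int \<Rightarrow> complex"
  assumes "n > 0"
  shows "(\<Sum>j<n. f ((int j - a) mod int n)) = (\<Sum>d<n. f (int d))"
proof (rule sum.reindex_bij_witness[of _ "\<lambda>d. nat ((int d + a) mod int n)"
      "\<lambda>j. nat ((int j - a) mod int n)"])
  fix j assume "j \<in> {..<n}"
  then show "nat ((int (nat ((int j - a) mod int n)) + a) mod int n) = j"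
    using assms by (simp add: mod_add_left_eq)
next
  fix d assume "d \<in> {..<n}"
  then show "nat ((int (nat ((int d + a) mod int n)) - a) mod int n) = d"
    using assms by (simp add: mod_diff_left_eq)
qed (use assms in \<open>auto simp: nat_less_iff\<close>)

text \<open>
  Substituting \<open>j = i + d\<close> pulls the factor that depends on \<open>i\<close> out of the sum. Thus each character,
  read as a column vector, is an eigenvector of every circulant matrix of size \<open>n\<close>.
\<close>

lemma circulant_mult_fourier:
  assumes "n > 0"
  shows "(\<Sum>j<n. c ((int j - int i) mod int n) * cyclic_char n (int k * int j))
    = cyclic_char n (int k * int i) * circulant_eigenvalue n c k"
proof -
  define h where "h d = c d * cyclic_char n (int k * d)" for d
  have "c ((int j - int i) mod int n) * cyclic_char n (int k * int j)
      = cyclic_char n (int k * int i) * h ((int j - int i) mod int n)" for j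
  proof -
    have "int n dvd (int j - int i) - (int j - int i) mod int n"
      by (rule dvd_minus_mod)
    then have "int n dvd int k * ((int j - int i) - (int j - int i) mod int n)"
      by (rule dvd_mult)
    then have "cyclic_char n (int k * int j)
        = cyclic_char n (int k * int i + int k * ((int j - int i) mod int n))"
      using assms by (intro cyclic_char_cong) (simp_all add: algebra_simps)
    then show ?thesis
      by (simp add: h_def cyclic_char_add)
  qed
  then have "(\<Sum>j<n. c ((int j - int i) mod int n) * cyclic_char n (int k * int j))
      = cyclic_char n (int k * int i) * (\<Sum>j<n. h ((int j - int i) mod int n))"
    by (simp only: sum_distrib_left)
  also have "(\<Sum>j<n. h ((int j - int i) mod int n)) = circulant_eigenvalue n c k"
    unfolding sum_mod_shift[OF assms] by (simp add: circulant_eigenvalue_def h_def)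
  finally show ?thesis .
qed

text \<open>
  The matrix \<open>F\<close> with the characters as its columns is invertible by orthogonality and conjugates the
  circulant matrix to the diagonal matrix of its eigenvalues. Diagonalising, rather than just
  exhibiting eigenvectors, is what yields the multiplicities.
\<close>

lemma char_poly_circulant:
  assumes n: "n > 0"
  shows "char_poly (circulant n c) = (\<Prod>k\<leftarrow>[0..<n]. [:- circulant_eigenvalue n c k, 1:])"
proof -
  define F where "F = mat n n (\<lambda>(i, k). cyclic_char n (int k * int i))"
  define F' where "F' = mat n n (\<lambda>(k, j). cyclic_char n (- (int k * int j)) / of_nat n)"
  define D where "D = mat n n (\<lambda>(k, l). if k = l then circulant_eigenvalue n c k else 0)"
  have carr [simp]: "F \<in> carrier_mat n n" "F' \<in> carrier_mat n n" "D \<in> carrier_mat n n"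
    "circulant n c \<in> carrier_mat n n"
    by (simp_all add: F_def F'_def D_def circulant_def)
  have orth: "(\<Sum>k<n. cyclic_char n (int k * int i) * (cyclic_char n (- (int k * int j)) / of_nat n))
      = of_bool (i = j)" if "i < n" "j < n" for i j
  proof -
    have "int n dvd int i - int j \<longleftrightarrow> i = j"
      using that by (metis mod_eq_dvd_iff mod_pos_pos_trivial of_nat_0_le_iff of_nat_eq_iff of_nat_less_iff)
    moreover have "(\<Sum>k<n. cyclic_char n (int k * int i) * (cyclic_char n (- (int k * int j)) / of_nat n))
       = (\<Sum>k<n. cyclic_char n ((int i - int j) * int k)) / of_nat n"
      by (simp add: sum_divide_distrib cyclic_char_add[symmetric] algebra_simps)
    ultimately show ?thesis
      using n by (simp add: sum_cyclic_char)
  qed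
  have FF': "F * F' = 1\<^sub>m n"
  proof (rule eq_matI)
    fix i j assume "i < dim_row (1\<^sub>m n :: complex mat)" "j < dim_col (1\<^sub>m n :: complex mat)"
    then have ij: "i < n" "j < n" by simp_all
    have "(F * F') $$ (i, j)
        = (\<Sum>k<n. cyclic_char n (int k * int i) * (cyclic_char n (- (int k * int j)) / of_nat n))"
      using ij by (simp add: F_def F'_def scalar_prod_def atLeast0LessThan)
    also have "\<dots> = 1\<^sub>m n $$ (i, j)"
      unfolding orth[OF ij] using ij by simp
    finally show "(F * F') $$ (i, j) = 1\<^sub>m n $$ (i, j)" .
  qed (simp_all add: F_def F'_def)
  have F'F: "F' * F = 1\<^sub>m n"
    by (rule mat_mult_left_right_inverse[OF _ _ FF']) simp_all
  have "circulant n c * F = F * D"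
  proof (rule eq_matI)
    fix i k assume "i < dim_row (F * D)" "k < dim_col (F * D)"
    then have ik: "i < n" "k < n" by (simp_all add: F_def D_def)
    have "(circulant n c * F) $$ (i, k) = cyclic_char n (int k * int i) * circulant_eigenvalue n c k"
      using ik circulant_mult_fourier[OF n, of c i k]
      by (simp add: circulant_def F_def scalar_prod_def atLeast0LessThan)
    also have "\<dots> = (F * D) $$ (i, k)"
      using ik by (simp add: F_def D_def scalar_prod_def atLeast0LessThan if_distrib cong: if_cong)
    finally show "(circulant n c * F) $$ (i, k) = (F * D) $$ (i, k)" .
  qed (simp_all add: F_def D_def circulant_def)
  then have "circulant n c = F * D * F'"
    using assoc_mult_mat[of "circulant n c" n n F n F' n] right_mult_one_mat[of "circulant n c" n n]
    by (simp add: FF')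
  then have "similar_mat_wit (circulant n c) D F F'"
    by (rule similar_mat_witI[OF FF' F'F]) simp_all
  then have "similar_mat (circulant n c) D"
    by (auto simp: similar_mat_def)
  then have "char_poly (circulant n c) = char_poly D"
    by (rule char_poly_similar)
  also have "\<dots> = (\<Prod>a\<leftarrow>diag_mat D. [:- a, 1:])"
    by (rule char_poly_upper_triangular[of _ n]) (auto simp: upper_triangular_def D_def)
  also have "diag_mat D = map (circulant_eigenvalue n c) [0..<n]"
    by (auto simp: diag_mat_def D_def)
  finally show ?thesis
    by (simp add: comp_def)
qed

lemma sum_proots_circulant:
  fixes f :: "complex \<Rightarrow> real"
  assumes "n > 0"
  shows "(\<Sum>z\<in>#proots (char_poly (circulant n c)). f z) = (\<Sum>k<n. f (circulant_eigenvalue n c k))"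
proof -
  have "(\<Prod>k\<leftarrow>[0..<n]. [:- circulant_eigenvalue n c k, 1:])
      = (\<Prod>k<n. [:- circulant_eigenvalue n c k, 1:])"
    by (simp add: prod.distinct_set_conv_list[symmetric] atLeast0LessThan)
  then have "proots (char_poly (circulant n c)) = (\<Sum>k<n. {#circulant_eigenvalue n c k#})"
    by (simp add: char_poly_circulant[OF assms] proots_prod)
  moreover have "(\<Sum>z\<in>#(\<Sum>k\<in>A. {#g k#}). f z) = (\<Sum>k\<in>A. f (g k))" if "finite A"
    for A :: "nat set" and g :: "nat \<Rightarrow> complex"
    using that by (induction A) auto
  ultimately show ?thesis by simp
qed

section \<open>The complement of a Hamilton cycle\<close>

lemma (in pre_digraph) tail_Suc_mod_closed_walk:
  assumes "cas u p u" "i < length p"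
  shows "tail G (p ! (Suc i mod length p)) = head G (p ! i)"
proof -
  have ne: "p \<noteq> []" using assms(2) by auto
  have eq: "map (tail G) p @ [head G (last p)] = tail G (hd p) # map (head G) p"
    using awalk_verts_conv[of u p] awalk_verts_conv'[OF assms(1)] ne by simp
  have last: "head G (last p) = v" if "cas w p v" "p \<noteq> []" for w v p
    using that by (induction w p v rule: cas.induct) auto
  show ?thesis
  proof (cases "Suc i < length p")
    case True
    then show ?thesis
      using arg_cong[OF eq, of "\<lambda>xs. xs ! Suc i"] by (simp add: nth_append)
  next
    case False
    then have "Suc i = length p" using assms(2) by simp
    moreover have "tail G (p ! 0) = u"
      using assms(1) ne by (cases p) auto
    ultimately show ?thesis
      using last[OF assms(1) ne] ne by (simp add: last_conv_nth flip: \<open>Suc i = length p\<close>)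
  qed
qed

text \<open>
  On the cycle through \<open>0, \<dots>, n - 1\<close>, the relations of being equal, successor or predecessor
  correspond to the residues \<open>0\<close>, \<open>1\<close> and \<open>-1\<close>, where \<open>-1\<close> is represented by \<open>n - 1\<close>.
\<close>

lemma cyclic_neighbour_iff:
  assumes "i < n" "j < n"
  shows "(int j - int i) mod int n = 0 \<longleftrightarrow> i = j"
    and "n \<ge> 2 \<Longrightarrow> (int j - int i) mod int n = 1 \<longleftrightarrow> j = Suc i mod n"
    and "n \<ge> 2 \<Longrightarrow> (int j - int i) mod int n = int n - 1 \<longleftrightarrow> i = Suc j mod n"
proof -
  have m: "(int j - int i) mod int n = (if i \<le> j then int j - int i else int j - int i + int n)"
  proof (cases "i \<le> j")
    case False
    have "(int j - int i) mod int n = (int j - int i + int n) mod int n" by simp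
    also have "\<dots> = int j - int i + int n"
      using False assms by (intro mod_pos_pos_trivial) auto
    finally show ?thesis using False by simp
  qed (use assms in auto)
  have s: "Suc k mod n = (if Suc k = n then 0 else Suc k)" if "k < n" for k
    using that by auto
  show "(int j - int i) mod int n = 0 \<longleftrightarrow> i = j"
    using assms by (auto simp: m)
  show "n \<ge> 2 \<Longrightarrow> (int j - int i) mod int n = 1 \<longleftrightarrow> j = Suc i mod n"
    using assms by (auto simp: m s)
  show "n \<ge> 2 \<Longrightarrow> (int j - int i) mod int n = int n - 1 \<longleftrightarrow> i = Suc j mod n"
    using assms by (auto simp: m s)
qed

text \<open>
  The row of index \<open>0\<close> of the adjacency matrix of the complement of the cycle through
  \<open>0, \<dots>, n - 1\<close>.
\<close>

definition co_cycle_row :: "nat \<Rightarrow> int \<Rightarrow> complex" where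
  "co_cycle_row n d = of_bool (d \<notin> {0, 1, int n - 1})"

text \<open>
  The heads of the arcs of \<open>H\<close> enumerate the vertices in cyclic order, without repetition because
  \<open>H\<close> is a cycle and completely because it is Hamiltonian. Consecutive entries are exactly the edges
  of \<open>H\<close>, so in this enumeration the adjacency matrix is circulant.
\<close>

lemma graph_energy_remove_hamilton_cycle:
  assumes n: "n \<ge> 2" and G: "complete_digraph n G" and H: "hamilton_cycle G H"
  shows "graph_energy (remove_edges G (set H))
    = (\<Sum>k<n. cmod (circulant_eigenvalue n (co_cycle_row n) k))"
proof -
  interpret graph G using G by (simp add: complete_digraph_def)
  have arcsG: "arcs_ends G = {(u, v). (u, v) \<in> verts G \<times> verts G \<and> u \<noteq> v}"
    and cardG: "card (verts G) = n"
    using G by (simp_all add: complete_digraph_def)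
  define vs where "vs = map (head G) H"
  let ?R = "remove_edges G (set H)"
  obtain u where u: "awalk u H u" "distinct (tl (awalk_verts u H))" "H \<noteq> []"
    using H by (auto simp: hamilton_cycle_def cycle_def)
  have cas: "cas u H u" using u(1) by (simp add: awalk_def)
  have dist: "distinct vs"
    using u(2,3) awalk_verts_conv'[OF cas] by (simp add: vs_def)
  have set_vs: "set vs = verts G"
    using H by (simp add: hamilton_cycle_def vs_def)
  have len: "length vs = n" "length H = n"
    using distinct_card[OF dist] cardG set_vs by (simp_all add: vs_def)
  \<comment> \<open>Since \<open>vs\<close> consists of the heads, the arc from \<open>vs ! m\<close> to its successor is the one after
    the \<open>m\<close>-th arc of \<open>H\<close>; hence the cyclic shift of the arcs.\<close>
  have edges: "(\<lambda>e. {tail G e, head G e}) ` set H = (\<lambda>m. {vs ! m, vs ! (Suc m mod n)}) ` {..<n}"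
  proof -
    have bij: "bij_betw (\<lambda>m. Suc m mod n) {..<n} {..<n}"
    proof -
      have "(\<lambda>m. Suc m mod n) ` {..<n} = {..<n}"
      proof (intro antisym subsetI)
        fix x assume x: "x \<in> {..<n}"
        show "x \<in> (\<lambda>m. Suc m mod n) ` {..<n}"
          using x by (intro image_eqI[of _ _ "if x = 0 then n - 1 else x - 1"]) auto
      qed (use n in auto)
      then show ?thesis
        by (simp add: bij_betw_def eq_card_imp_inj_on)
    qed
    have "set H = (\<lambda>m. H ! m) ` {..<n}"
      using len by (auto simp: set_conv_nth)
    also have "{..<n} = (\<lambda>m. Suc m mod n) ` {..<n}"
      using bij by (simp add: bij_betw_def)
    finally have "set H = (\<lambda>m. H ! (Suc m mod n)) ` {..<n}"
      by (simp add: image_image)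
    then show ?thesis
      using tail_Suc_mod_closed_walk[OF cas] len n
      by (auto simp: image_image vs_def intro!: image_cong)
  qed
  have ends: "(x, y) \<in> arcs_ends ?R \<longleftrightarrow>
      (x, y) \<in> arcs_ends G \<and> {x, y} \<notin> (\<lambda>e. {tail G e, head G e}) ` set H" for x y
    by (force simp: arcs_ends_conv remove_edges_def)
  have entry: "(vs ! i, vs ! j) \<in> arcs_ends ?R
      \<longleftrightarrow> (int j - int i) mod int n \<notin> {0, 1, int n - 1}" if "i < n" "j < n" for i j
  proof -
    have inj: "vs ! a = vs ! b \<longleftrightarrow> a = b" if "a < n" "b < n" for a b
      using that dist len by (simp add: nth_eq_iff_index_eq)
    have "(vs ! i, vs ! j) \<in> arcs_ends G \<longleftrightarrow> i \<noteq> j"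
      using that len set_vs nth_mem[of i vs] nth_mem[of j vs] by (auto simp: arcsG inj)
    moreover have "{vs ! i, vs ! j} \<in> (\<lambda>m. {vs ! m, vs ! (Suc m mod n)}) ` {..<n}
        \<longleftrightarrow> j = Suc i mod n \<or> i = Suc j mod n"
      using that n by (auto simp: doubleton_eq_iff inj image_iff)
    ultimately show ?thesis
      using cyclic_neighbour_iff[OF that] n unfolding ends edges by simp
  qed
  have "adjacency_matrix ?R vs = circulant n (co_cycle_row n)"
    by (rule eq_matI) (simp_all add: adjacency_matrix_def circulant_def co_cycle_row_def len entry)
  moreover have "graph_energy ?R = (\<Sum>z\<in>#proots (char_poly (adjacency_matrix ?R vs)). cmod z)"
    using dist set_vs by (intro graph_energy_eq) (simp_all add: remove_edges_def)
  ultimately show ?thesis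
    using n by (simp add: sum_proots_circulant)
qed

text \<open>
  The sum of a character over all residues vanishes except for \<open>k = 0\<close>; subtracting the terms for the
  residues \<open>0\<close>, \<open>1\<close> and \<open>-1\<close> leaves the stated value. The three residues are distinct because
  \<open>n \<ge> 3\<close>.
\<close>

lemma circulant_eigenvalue_co_cycle_row:
  assumes n: "n \<ge> 3" and k: "k < n"
  shows "circulant_eigenvalue n (co_cycle_row n) k
    = of_real (of_bool (k = 0) * real n - 1 - 2 * cos (2 * pi * real k / real n))"
proof -
  have "(\<Sum>d<n. co_cycle_row n (int d) * cyclic_char n (int k * int d))
      = (\<Sum>d<n. cyclic_char n (int k * int d)) - (\<Sum>d\<in>{0, 1, n - 1}. cyclic_char n (int k * int d))"
  proof -
    have "(\<Sum>d<n. co_cycle_row n (int d) * cyclic_char n (int k * int d))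
        = (\<Sum>d\<in>{..<n} - {0, 1, n - 1}. cyclic_char n (int k * int d))"
      using n by (intro sum.mono_neutral_cong_right) (auto simp: co_cycle_row_def of_nat_diff)
    also have "\<dots> = (\<Sum>d<n. cyclic_char n (int k * int d)) - (\<Sum>d\<in>{0, 1, n - 1}. cyclic_char n (int k * int d))"
      using n by (intro sum_diff) auto
    finally show ?thesis .
  qed
  moreover have "(\<Sum>d<n. cyclic_char n (int k * int d)) = of_bool (k = 0) * of_nat n"
    using n k by (cases "k = 0") (auto simp: sum_cyclic_char dest: dvd_imp_le)
  moreover have "(\<Sum>d\<in>{0, 1, n - 1}. cyclic_char n (int k * int d))
      = 1 + (cyclic_char n (int k) + cyclic_char n (int k * int (n - 1)))"
    using n by simp
  moreover have "cyclic_char n (int k * int (n - 1)) = cyclic_char n (- int k)"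
    using n by (intro cyclic_char_cong) (simp_all add: of_nat_diff algebra_simps)
  moreover have "cyclic_char n (int k) + cyclic_char n (- int k) = of_real (2 * cos (2 * pi * real k / real n))"
    by (simp add: cyclic_char_def complex_eq_iff)
  ultimately show ?thesis
    by (simp add: circulant_eigenvalue_def)
qed

section \<open>Signs of the eigenvalues and the trigonometric sum\<close>

text \<open>Reflecting at \<open>\<pi>\<close> reduces the claim to the monotonicity of the cosine on \<open>[0, \<pi>]\<close>.\<close>

lemma cos_le_minus_half_iff:
  fixes x :: real
  assumes "0 \<le> x" "x \<le> 2 * pi"
  shows "cos x \<le> - (1 / 2) \<longleftrightarrow> 2 * pi / 3 \<le> x \<and> x \<le> 4 * pi / 3"
proof -
  have "cos x = - cos \<bar>x - pi\<bar>"
    by (simp add: cos_diff)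
  then have "cos x \<le> - (1 / 2) \<longleftrightarrow> cos (pi / 3) \<le> cos \<bar>x - pi\<bar>"
    unfolding cos_60 by linarith
  also have "\<dots> \<longleftrightarrow> \<bar>x - pi\<bar> \<le> pi / 3"
    using assms by (intro cos_mono_le_eq) (auto simp: abs_le_iff)
  also have "\<dots> \<longleftrightarrow> 2 * pi / 3 \<le> x \<and> x \<le> 4 * pi / 3"
    unfolding abs_le_iff by linarith
  finally show ?thesis .
qed

text \<open>
  Multiplying by \<open>2 sin (t / 2)\<close> turns \<open>cos (k t)\<close> into the difference
  \<open>sin ((k + 1/2) t) - sin ((k - 1/2) t)\<close>.
\<close>

lemma sum_cos_telescope:
  fixes t :: real
  assumes "a \<le> b"
  shows "2 * sin (t / 2) * (\<Sum>k\<in>{a<..b}. cos (real k * t))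
    = sin ((real b + 1 / 2) * t) - sin ((real a + 1 / 2) * t)"
  using assms
proof (induction b rule: dec_induct)
  case (step b)
  have "{a<..Suc b} = insert (Suc b) {a<..b}"
    using step.hyps by auto
  moreover have "2 * sin (t / 2) * cos (real (Suc b) * t)
      = sin ((real (Suc b) + 1 / 2) * t) - sin ((real b + 1 / 2) * t)"
    using sin_diff_sin[of "(real (Suc b) + 1 / 2) * t" "(real b + 1 / 2) * t"]
    by (simp add: algebra_simps add_divide_distrib)
  ultimately show ?case
    using step.IH by (simp add: distrib_left)
qed simp

theorem mainTheorem2:
  fixes n :: nat and G :: "('a, 'b) pre_digraph" and H :: "'b awalk"
  assumes "n \<ge> 3" and "complete_digraph n G" and "hamilton_cycle G H"
  shows "graph_energy (remove_edges G (set H)) =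
    2 * (real n - 3 - (real_of_int \<lfloor>2 * real n / 3\<rfloor> - real_of_int \<lfloor>real n / 3\<rfloor>))
    + 2 * ((sin ((real_of_int \<lfloor>real n / 3\<rfloor> + 1 / 2) * 2 * pi / real n)
            - sin ((real_of_int \<lfloor>2 * real n / 3\<rfloor> + 1 / 2) * 2 * pi / real n))
           / sin (pi / real n))"
proof -
  define a b where "a = n div 3" and "b = 2 * n div 3"
  define t where "t = 2 * pi / real n"
  define \<mu> where "\<mu> k = of_bool (k = 0) * real n - 1 - 2 * cos (real k * t)" for k
  have n: "n > 0" and ab: "a \<le> b" "b < n"
    using assms(1) by (auto simp: a_def b_def)
  have fl: "\<lfloor>real n / 3\<rfloor> = int a" "\<lfloor>2 * real n / 3\<rfloor> = int b"
    using floor_divide_of_nat_eq[of n 3, where 'a = real]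
      floor_divide_of_nat_eq[of "2 * n" 3, where 'a = real]
    by (simp_all add: a_def b_def)
  have energy: "graph_energy (remove_edges G (set H)) = (\<Sum>k<n. \<bar>\<mu> k\<bar>)"
    using assms(1) graph_energy_remove_hamilton_cycle[OF _ assms(2,3)]
    by (simp add: circulant_eigenvalue_co_cycle_row \<mu>_def t_def mult.commute norm_of_real
        del: of_real_diff of_real_mult)
  \<comment> \<open>The trace of the adjacency matrix, computed from the eigenvalues.\<close>
  have trace: "(\<Sum>k<n. \<mu> k) = 0"
  proof -
    have "(\<Sum>k<n. cos (real k * t)) = Re (\<Sum>k<n. cyclic_char n (1 * int k))"
      by (simp add: cyclic_char_def t_def mult.commute)
    also have "\<dots> = 0"
      unfolding sum_cyclic_char[OF n] using assms(1) by auto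
    finally have "(\<Sum>k<n. cos (real k * t)) = 0" .
    moreover have "(\<Sum>k<n. of_bool (k = 0) * real n) = real n"
      using n by (subst sum.remove[of _ 0]) auto
    ultimately show ?thesis
      unfolding \<mu>_def sum_subtractf by (simp flip: sum_distrib_left)
  qed
  \<comment> \<open>The identity \<open>\<bar>x\<bar> = 2 max x 0 - x\<close>, where the set of indices selects the nonnegative eigenvalues
    up to ones that vanish.\<close>
  have sgn: "\<bar>\<mu> k\<bar> = 2 * (if k \<in> insert 0 {a<..b} then \<mu> k else 0) - \<mu> k" if k: "k < n" for k
  proof (cases "k = 0")
    case True
    then show ?thesis using assms(1) by (simp add: \<mu>_def)
  next
    case False
    have *: "cos (real k * t) \<le> - (1 / 2) \<longleftrightarrow> n \<le> 3 * k \<and> 3 * k \<le> 2 * n"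
    proof -
      have "2 * pi / 3 \<le> real k * t \<longleftrightarrow> real n \<le> real (3 * k)"
        "real k * t \<le> 4 * pi / 3 \<longleftrightarrow> real (3 * k) \<le> real (2 * n)"
        "real k * t \<le> 2 * pi" "0 \<le> real k * t"
        using n k by (simp_all add: t_def field_simps)
      then show ?thesis
        by (simp only: cos_le_minus_half_iff of_nat_le_iff)
    qed
    show ?thesis
    proof (cases "k \<in> {a<..b}")
      case True
      then have "n \<le> 3 * k \<and> 3 * k \<le> 2 * n"
        by (auto simp: a_def b_def)
      with * True False show ?thesis by (simp add: \<mu>_def)
    next
      case out: False
      have "cos (real k * t) \<ge> - (1 / 2)"
      \<comment> \<open>If \<open>3\<close> divides \<open>n\<close>, the index \<open>k = n / 3\<close> satisfies \<open>*\<close> but lies outside \<open>{a<..b}\<close>; its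
        eigenvalue is zero.\<close>
      proof (cases "3 * k = n")
        case True
        then have "real k * t = 2 * pi / 3"
          using n by (auto simp: t_def field_simps)
        then show ?thesis by (simp only: cos_120)
      next
        case False
        with out have "\<not> (n \<le> 3 * k \<and> 3 * k \<le> 2 * n)"
          by (auto simp: a_def b_def)
        with * show ?thesis by linarith
      qed
      then have "\<mu> k \<le> 0"
        using \<open>k \<noteq> 0\<close> by (simp add: \<mu>_def)
      moreover have "k \<notin> insert 0 {a<..b}"
        using out \<open>k \<noteq> 0\<close> by blast
      ultimately show ?thesis
        by (simp only: if_False)
    qed
  qed
  have "(\<Sum>k<n. \<bar>\<mu> k\<bar>) = 2 * (\<Sum>k<n. if k \<in> insert 0 {a<..b} then \<mu> k else 0)"
    using trace by (simp add: sgn sum_subtractf flip: sum_distrib_left)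
  also have "(\<Sum>k<n. if k \<in> insert 0 {a<..b} then \<mu> k else 0) = (\<Sum>k\<in>insert 0 {a<..b}. \<mu> k)"
    using ab n by (subst sum.inter_restrict[symmetric]) (auto intro!: sum.cong)
  also have "\<dots> = real n - 3 - (real b - real a) - 2 * (\<Sum>k\<in>{a<..b}. cos (real k * t))"
    using ab by (simp add: \<mu>_def sum_subtractf of_nat_diff flip: sum_distrib_left)
  also have "2 * (\<Sum>k\<in>{a<..b}. cos (real k * t))
      = (sin ((real b + 1 / 2) * t) - sin ((real a + 1 / 2) * t)) / sin (pi / real n)"
  proof -
    have "sin (pi / real n) > 0"
      using assms(1) by (intro sin_gt_zero) (auto simp: field_simps)
    then show ?thesis
      using sum_cos_telescope[OF ab(1), of t] by (simp add: t_def field_simps)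
  qed
  finally show ?thesis
    unfolding energy fl by (simp add: t_def diff_divide_distrib algebra_simps)
qed

end
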